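(* Let $\Pi(\hat{\mathcal X})$ denote the feasible region of the mixed-integer system (MIP) and let $\hat{\mathcal V}=\mathrm{Proj}_v(\Pi(\hat{\mathcal X}))\setminus\{0\}$ be the set of nonzero vectors $v$ occurring in its feasible solutions. Then the set $\hat{\mathcal C}$ of all inverse-feasible cost vectors for $\mathbf{QIO}(\mathcal K,\tau,\theta)$ is, up to the normalization $\|c\|_p=1$, the set $\bigcup_{v\in\hat{\mathcal V}}\mathrm{cone}(\{a^i\}_{i:v_i=1})$; that is, $$\hat{\mathcal C}=\Big\{c\in\bigcup_{v\in\hat{\mathcal V}}\mathrm{cone}(\{a^i\}_{i:v_i=1})\;:\;\|c\|_p=1\Big\}.$$
   Context: Setting: $A\in\mathbb R^{m\times n}$, $b\in\mathbb R^m$, $\mathcal I=\{1,\dots,m\}$; $a^i\in\mathbb R^n$ is the $i$-th row of $A$ written as a column vector; prime denotes transpose. The forward feasible region $\mathcal X=\{x\in\mathbb R^n: Ax\ge b\}$ is bounded, full-dimensional and free of redundant constraints. Norm parameters $\ell,p\ge1$ (possibly $\infty$) are fixed, and $\|a^i\|_p=1$ for all $i$. The dataset $\hat{\mathcal X}=\{\hat x^1,\dots,\hat x^K\}\subset\mathbb R^n$ is indexed by $\mathcal K=\{1,\dots,K\}$, with no assumption on feasibility or optimality of the points. $\tau\ge0$ and $\theta\in[0,1]$. $\mathrm{cone}(\cdot)$ is the set of conic (nonnegative linear) combinations of the given vectors. Quantile inverse optimization problem $\mathbf{QIO}(\mathcal K,\tau,\theta)$: find $c\in\mathbb R^n$,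 $\{\epsilon^k\}_{k\in\mathcal K}\subset\mathbb R^n$, $y\in\mathbb R^m$, $\mathcal S\subseteq\mathcal K$ such that $A'y=c$, $y\ge0$; $A(\hat x^k-\epsilon^k)\ge b$, $c'(\hat x^k-\epsilon^k)=b'y$ and $\|\epsilon^k\|_\ell\le\tau$ for all $k\in\mathcal S$; $|\mathcal S|\ge\theta K$; and $\|c\|_p=1$. A cost vector $c$ is inverse-feasible if it is the $c$-component of such a feasible solution. System (MIP), in $v\in\{0,1\}^m$, $u\in\{0,1\}^K$, $\epsilon^k\in\mathbb R^n$ ($k\in\mathcal K$): $b_i\le {a^i}'(\hat x^k-\epsilon^k)\le b_i+M_1(1-v_i)$ for all $i\in\mathcal I,k\in\mathcal K$; $\|\epsilon^k\|_\ell\le\tau+M_2(1-u_k)$ for all $k\in\mathcal K$; $\sum_{k=1}^K u_k\ge\theta K$. Here $M_1,M_2$ are sufficiently large constants, i.e. $M_1\ge\max_{i\in\mathcal I,x\in\mathcal X}({a^i}'x-b_i)$ and $M_2\ge\max_{k\in\mathcal K,x\in\mathcal X}\|\hat x^k-x\|_\ell$. *)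

theory Defs
  imports "HOL-Analysis.Analysis" "HOL-Library.Extended_Real"
begin

text \<open>The norm on \<open>\<real>\<^sup>n\<close> with parameter \<open>1 \<le> p \<le> \<infinity>\<close>; other values of \<open>p\<close> are meaningless.\<close>

definition pnorm :: "ereal \<Rightarrow> real ^ 'n \<Rightarrow> real" where
  "pnorm p x =
     (if p = \<infinity> then infnorm x
      else (\<Sum>i\<in>UNIV. \<bar>x $ i\<bar> powr real_of_ereal p) powr (1 / real_of_ereal p))"

definition feasible_region :: "real ^ 'n ^ 'm \<Rightarrow> real ^ 'm \<Rightarrow> (real ^ 'n) set" where
  "feasible_region A b = {x. b \<le> A *v x}"

definition no_redundant_constraint :: "real ^ 'n ^ 'm \<Rightarrow> real ^ 'm \<Rightarrow> bool" where
  "no_redundant_constraint A b \<longleftrightarrow>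
     (\<forall>i. {x. \<forall>j. j \<noteq> i \<longrightarrow> b $ j \<le> row j A \<bullet> x} \<noteq> feasible_region A b)"

text \<open>Not to be confused with the library's \<^const>\<open>cone\<close>, a predicate on sets that asks only for
  closure under nonnegative scaling.\<close>

definition conic_combinations :: "'a::real_vector set \<Rightarrow> 'a set" where
  "conic_combinations V =
     {\<Sum>x\<in>T. w x *\<^sub>R x | T w. finite T \<and> T \<subseteq> V \<and> (\<forall>x\<in>T. 0 \<le> w x)}"

text \<open>The data points \<open>xh k\<close> are indexed by a finite type \<open>'k\<close>, so \<open>K = CARD('k) \<ge> 1\<close>, and
  \<open>e k\<close> is the perturbation of \<open>xh k\<close>.\<close>

definition qio_feasible ::
  "real ^ 'n ^ 'm \<Rightarrow> real ^ 'm \<Rightarrow> ereal \<Rightarrow> ereal \<Rightarrow> ('k::finite \<Rightarrow> real ^ 'n) \<Rightarrow> real \<Rightarrow> real \<Rightarrow>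
   real ^ 'n \<Rightarrow> ('k \<Rightarrow> real ^ 'n) \<Rightarrow> real ^ 'm \<Rightarrow> 'k set \<Rightarrow> bool" where
  "qio_feasible A b l p xh \<tau> \<theta> c e y S \<longleftrightarrow>
     transpose A *v y = c \<and> 0 \<le> y \<and>
     (\<forall>k\<in>S. b \<le> A *v (xh k - e k) \<and> c \<bullet> (xh k - e k) = b \<bullet> y \<and> pnorm l (e k) \<le> \<tau>) \<and>
     \<theta> * real CARD('k) \<le> real (card S) \<and>
     pnorm p c = 1"

definition inverse_feasible ::
  "real ^ 'n ^ 'm \<Rightarrow> real ^ 'm \<Rightarrow> ereal \<Rightarrow> ereal \<Rightarrow> ('k::finite \<Rightarrow> real ^ 'n) \<Rightarrow> real \<Rightarrow> real \<Rightarrow>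
   real ^ 'n \<Rightarrow> bool" where
  "inverse_feasible A b l p xh \<tau> \<theta> c \<longleftrightarrow> (\<exists>e y S. qio_feasible A b l p xh \<tau> \<theta> c e y S)"

definition mip_region ::
  "real ^ 'n ^ 'm \<Rightarrow> real ^ 'm \<Rightarrow> ereal \<Rightarrow> ('k::finite \<Rightarrow> real ^ 'n) \<Rightarrow> real \<Rightarrow> real \<Rightarrow> real \<Rightarrow> real \<Rightarrow>
   ((real ^ 'm) \<times> (real ^ 'k) \<times> ('k \<Rightarrow> real ^ 'n)) set" where
  "mip_region A b l xh \<tau> \<theta> M1 M2 =
     {(v, u, e).
        (\<forall>i. v $ i \<in> {0, 1}) \<and> (\<forall>k. u $ k \<in> {0, 1}) \<and>
        (\<forall>i k. b $ i \<le> row i A \<bullet> (xh k - e k) \<and>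
               row i A \<bullet> (xh k - e k) \<le> b $ i + M1 * (1 - v $ i)) \<and>
        (\<forall>k. pnorm l (e k) \<le> \<tau> + M2 * (1 - u $ k)) \<and>
        \<theta> * real CARD('k) \<le> (\<Sum>k\<in>UNIV. u $ k)}"

definition mip_nonzero_v ::
  "real ^ 'n ^ 'm \<Rightarrow> real ^ 'm \<Rightarrow> ereal \<Rightarrow> ('k::finite \<Rightarrow> real ^ 'n) \<Rightarrow> real \<Rightarrow> real \<Rightarrow> real \<Rightarrow> real \<Rightarrow>
   (real ^ 'm) set" where
  "mip_nonzero_v A b l xh \<tau> \<theta> M1 M2 = fst ` mip_region A b l xh \<tau> \<theta> M1 M2 - {0}"

end

theory Submission
  imports Defs
begin

text \<open>A solution of the inverse problem is a dual vector \<open>y\<close> that is complementary to all selected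
  perturbed points, so the indicator of the support of \<open>y\<close> is an admissible \<open>v\<close>. The mixed-integer
  system also constrains the points that are not selected: they are all sent to one selected
  perturbed point, which \<open>M2\<close> allows. If no point is selected (possible for \<open>\<theta> = 0\<close>), \<open>y\<close> carries no
  information; it is replaced by an optimal dual solution at a minimiser of \<open>c\<close> over the
  compact feasible region, which exists by Farkas' lemma. Conversely, the multipliers of a conic
  combination of the rows with \<open>v $ i = 1\<close> are complementary to all perturbed points.\<close>

section \<open>Finitely generated cones and Farkas' lemma\<close>

lemma conic_combinations_eq_convex_cone_hull: "conic_combinations V = convex_cone hull V"
proof
  have cone: "convex_cone (convex_cone hull V)"
    by (rule convex_cone_convex_cone_hull)
  have "(\<Sum>x\<in>T. w x *\<^sub>R x) \<in> convex_cone hull V"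
    if "finite T" "T \<subseteq> V" "\<forall>x\<in>T. 0 \<le> w x" for T and w :: "'a \<Rightarrow> real"
    using that
    by (induction T)
      (auto intro: convex_cone_add[OF cone] convex_cone_scaleR[OF cone] hull_inc
        convex_cone_contains_0[OF cone])
  then show "conic_combinations V \<subseteq> convex_cone hull V"
    unfolding conic_combinations_def by blast
next
  \<comment> \<open>By minimality of the hull it suffices that the conic combinations form a convex
    cone containing \<open>V\<close>.\<close>
  have zero: "0 \<in> conic_combinations V"
    unfolding conic_combinations_def by (auto intro!: exI[of _ "{}"])
  have add: "x + y \<in> conic_combinations V"
    if x: "x \<in> conic_combinations V" and y: "y \<in> conic_combinations V" for x y
  proof -
    obtain T w where T: "finite T" "T \<subseteq> V" "\<forall>x\<in>T. 0 \<le> w x" "x = (\<Sum>x\<in>T. w x *\<^sub>R x)"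
      using x unfolding conic_combinations_def by blast
    obtain T' w' where T': "finite T'" "T' \<subseteq> V" "\<forall>x\<in>T'. 0 \<le> w' x" "y = (\<Sum>x\<in>T'. w' x *\<^sub>R x)"
      using y unfolding conic_combinations_def by blast
    \<comment> \<open>The index sets may overlap, so both weight functions are extended by zero to
      \<open>T \<union> T'\<close> before being added.\<close>
    define f where "f z = (if z \<in> T then w z else 0)" for z
    define f' where "f' z = (if z \<in> T' then w' z else 0)" for z
    have "x = (\<Sum>z\<in>T \<union> T'. f z *\<^sub>R z)"
      unfolding T(4) by (rule sum.mono_neutral_cong_left) (auto simp: f_def T(1) T'(1))
    moreover have "y = (\<Sum>z\<in>T \<union> T'. f' z *\<^sub>R z)"
      unfolding T'(4) by (rule sum.mono_neutral_cong_left) (auto simp: f'_def T(1) T'(1))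
    ultimately have "x + y = (\<Sum>z\<in>T \<union> T'. (f z + f' z) *\<^sub>R z)"
      by (simp add: scaleR_add_left sum.distrib)
    moreover have "\<forall>z\<in>T \<union> T'. 0 \<le> f z + f' z"
      using T(3) T'(3) by (auto simp: f_def f'_def)
    ultimately show ?thesis
      unfolding conic_combinations_def mem_Collect_eq
      by (intro exI[of _ "T \<union> T'"] exI[of _ "\<lambda>z. f z + f' z"]) (use T T' in auto)
  qed
  have scale: "r *\<^sub>R x \<in> conic_combinations V"
    if x: "x \<in> conic_combinations V" and r: "0 \<le> r" for x r
  proof -
    obtain T w where T: "finite T" "T \<subseteq> V" "\<forall>x\<in>T. 0 \<le> w x" "x = (\<Sum>x\<in>T. w x *\<^sub>R x)"
      using x unfolding conic_combinations_def by blast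
    show ?thesis
      unfolding conic_combinations_def mem_Collect_eq
      by (intro exI[of _ T] exI[of _ "\<lambda>z. r * w z"]) (use T r in \<open>auto simp: scaleR_sum_right\<close>)
  qed
  have gen: "x \<in> conic_combinations V" if "x \<in> V" for x
    unfolding conic_combinations_def mem_Collect_eq
    by (intro exI[of _ "{x}"] exI[of _ "\<lambda>_. 1"]) (use that in auto)
  show "convex_cone hull V \<subseteq> conic_combinations V"
    by (rule hull_minimal) (use zero add scale gen in \<open>auto simp: convex_cone_iff\<close>)
qed

text \<open>A finitely generated cone is polyhedral, hence closed, so a hyperplane strictly
  separates \<open>c\<close> from it. A linear functional bounded below on a cone cannot be negative
  on a generator.\<close>

lemma farkas:
  fixes c :: "'a::euclidean_space"
  assumes "finite V" and "c \<notin> conic_combinations V"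
  obtains d where "d \<bullet> c < 0" and "\<And>a. a \<in> V \<Longrightarrow> 0 \<le> d \<bullet> a"
proof -
  let ?C = "convex_cone hull V"
  have cone: "convex_cone ?C"
    by (rule convex_cone_convex_cone_hull)
  have "closed ?C"
    by (intro polyhedron_imp_closed polyhedron_convex_cone_hull assms)
  moreover have "c \<notin> ?C"
    using assms by (simp add: conic_combinations_eq_convex_cone_hull)
  ultimately obtain d \<beta> where d: "d \<bullet> c < \<beta>" "\<And>x. x \<in> ?C \<Longrightarrow> \<beta> < d \<bullet> x"
    using separating_hyperplane_closed_point[OF convex_convex_cone_hull] by metis
  have "\<beta> < 0"
    using d(2)[OF convex_cone_hull_contains_0] by simp
  have "0 \<le> d \<bullet> a" if "a \<in> V" for a
  proof (rule ccontr)
    assume "\<not> 0 \<le> d \<bullet> a"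
    then have neg: "d \<bullet> a < 0" by simp
    \<comment> \<open>The factor is a quotient of two negative numbers, chosen so that
      \<open>d\<close> takes exactly the value \<open>\<beta>\<close> at the scaled vector, against
      strict separation.\<close>
    then have "(\<beta> / (d \<bullet> a)) *\<^sub>R a \<in> ?C"
      using that \<open>\<beta> < 0\<close>
      by (intro convex_cone_scaleR[OF cone] hull_inc) (auto simp: divide_nonpos_nonpos)
    from d(2)[OF this] neg show False by simp
  qed
  moreover have "d \<bullet> c < 0"
    using d(1) \<open>\<beta> < 0\<close> by simp
  ultimately show thesis by (rule that[rotated])
qed

text \<open>Otherwise Farkas' lemma yields a direction \<open>d\<close> that decreases
  \<open>c\<close> and decreases no active constraint. The inactive constraints have slack and there
  are finitely many of them, so a short step along \<open>d\<close> stays feasible and improves on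
  the minimiser.\<close>

lemma linear_minimizer_in_active_cone:
  fixes a :: "'i::finite \<Rightarrow> 'a::euclidean_space" and b :: "'i \<Rightarrow> real"
  assumes feas: "\<And>i. b i \<le> a i \<bullet> x"
    and min: "\<And>z. (\<And>i. b i \<le> a i \<bullet> z) \<Longrightarrow> c \<bullet> x \<le> c \<bullet> z"
  shows "c \<in> conic_combinations {a i | i. a i \<bullet> x = b i}"
proof (rule ccontr)
  assume "c \<notin> conic_combinations {a i | i. a i \<bullet> x = b i}"
  then obtain d where d: "d \<bullet> c < 0" "\<And>i. a i \<bullet> x = b i \<Longrightarrow> 0 \<le> d \<bullet> a i"
    by (rule farkas[rotated]) auto
  have "\<forall>\<^sub>F t in at_right 0. b i \<le> a i \<bullet> (x + t *\<^sub>R d)" for i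
  proof (cases "a i \<bullet> x = b i")
    case True
    then have "0 \<le> a i \<bullet> d"
      using d(2) by (simp add: inner_commute)
    then have "b i \<le> a i \<bullet> (x + t *\<^sub>R d)" if "0 < t" for t
      using that True by (simp add: inner_add_right)
    then show ?thesis
      by (auto simp: eventually_at_filter intro: always_eventually)
  next
    case False
    have "((\<lambda>t. a i \<bullet> (x + t *\<^sub>R d)) \<longlongrightarrow> a i \<bullet> (x + 0 *\<^sub>R d)) (at_right 0)"
      by (intro tendsto_intros)
    then have "\<forall>\<^sub>F t in at_right 0. b i < a i \<bullet> (x + t *\<^sub>R d)"
      by (rule order_tendstoD) (use feas[of i] False in simp)
    then show ?thesis
      by eventually_elim simp
  qed
  then have "\<forall>\<^sub>F t in at_right 0. \<forall>i. b i \<le> a i \<bullet> (x + t *\<^sub>R d)"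
    by (simp add: eventually_all_finite)
  then have "\<forall>\<^sub>F t::real in at_right 0. 0 < t \<and> (\<forall>i. b i \<le> a i \<bullet> (x + t *\<^sub>R d))"
    using eventually_at_right_less[of 0] by eventually_elim simp
  then obtain t :: real where t: "0 < t" "\<And>i. b i \<le> a i \<bullet> (x + t *\<^sub>R d)"
    using eventually_happens'[OF trivial_limit_at_right_real] by blast
  have "c \<bullet> x \<le> c \<bullet> (x + t *\<^sub>R d)"
    by (rule min) (rule t(2))
  then have "0 \<le> t * (d \<bullet> c)"
    by (simp add: inner_add_right inner_commute)
  with d(1) t(1) show False
    by (simp add: zero_le_mult_iff)
qed

section \<open>Dual multipliers and complementary slackness\<close>

lemma transpose_mult_eq_sum_rows:
  fixes A :: "real ^ 'n ^ 'm"
  shows "transpose A *v y = (\<Sum>i\<in>UNIV. y $ i *\<^sub>R row i A)"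
  by (simp add: vec_eq_iff matrix_vector_mult_def transpose_def row_def mult.commute)

text \<open>Passes from weights on vectors to weights on row indices. Working with hulls avoids
  choosing an index for each row, even if rows coincide: the admissible \<open>y\<close> form a
  convex cone, and its linear image is a convex cone containing the rows in question.\<close>

lemma conic_combinations_rows_iff:
  fixes A :: "real ^ 'n ^ 'm"
  shows "c \<in> conic_combinations {row i A | i. P i} \<longleftrightarrow>
    (\<exists>y. 0 \<le> y \<and> (\<forall>i. y $ i \<noteq> 0 \<longrightarrow> P i) \<and> transpose A *v y = c)"
proof
  let ?Y = "{y :: real ^ 'm. 0 \<le> y \<and> (\<forall>i. y $ i \<noteq> 0 \<longrightarrow> P i)}"
  have "convex_cone ?Y"
    by (auto simp: convex_cone_iff less_eq_vec_def add_nonneg_eq_0_iff)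
  then have "convex_cone ((\<lambda>y. transpose A *v y) ` ?Y)"
    by (intro convex_cone_linear_image conjI matrix_vector_mul_linear)
  moreover have "row i A \<in> (\<lambda>y. transpose A *v y) ` ?Y" if "P i" for i
  proof (rule image_eqI)
    show "row i A = transpose A *v axis i 1"
      by (metis column_transpose matrix_vector_mult_basis)
    show "axis i 1 \<in> ?Y"
      using that by (auto simp: axis_def less_eq_vec_def)
  qed
  ultimately have "convex_cone hull {row i A | i. P i} \<subseteq> (\<lambda>y. transpose A *v y) ` ?Y"
    by (intro hull_minimal) auto
  then show "\<exists>y. 0 \<le> y \<and> (\<forall>i. y $ i \<noteq> 0 \<longrightarrow> P i) \<and> transpose A *v y = c"
    if "c \<in> conic_combinations {row i A | i. P i}"
    using that unfolding conic_combinations_eq_convex_cone_hull by auto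
next
  assume "\<exists>y. 0 \<le> y \<and> (\<forall>i. y $ i \<noteq> 0 \<longrightarrow> P i) \<and> transpose A *v y = c"
  then obtain y where y: "0 \<le> y" "\<And>i. y $ i \<noteq> 0 \<Longrightarrow> P i" "c = transpose A *v y"
    by blast
  let ?C = "convex_cone hull {row i A | i. P i}"
  have cone: "convex_cone ?C"
    by (rule convex_cone_convex_cone_hull)
  have "y $ i *\<^sub>R row i A \<in> ?C" for i
  proof (cases "y $ i = 0")
    case False
    then have "row i A \<in> ?C"
      using y(2) by (auto intro: hull_inc)
    then show ?thesis
      using y(1) by (simp add: less_eq_vec_def convex_cone_scaleR[OF cone])
  qed (simp add: convex_cone_contains_0[OF cone])
  then have "(\<Sum>i\<in>F. y $ i *\<^sub>R row i A) \<in> ?C" for F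
    by (induction F rule: infinite_finite_induct)
      (auto intro: convex_cone_add[OF cone] convex_cone_contains_0[OF cone])
  then show "c \<in> conic_combinations {row i A | i. P i}"
    unfolding conic_combinations_eq_convex_cone_hull y(3) transpose_mult_eq_sum_rows .
qed

lemma mem_feasible_region_iff: "x \<in> feasible_region A b \<longleftrightarrow> (\<forall>i. b $ i \<le> row i A \<bullet> x)"
  by (simp add: feasible_region_def less_eq_vec_def matrix_vector_mul_component row_def)

text \<open>The duality gap is the sum of the products of multiplier and slack. All of them are
  nonnegative, so the gap vanishes exactly when each product does.\<close>

lemma complementary_slackness:
  fixes A :: "real ^ 'n ^ 'm"
  assumes "0 \<le> y" and "x \<in> feasible_region A b"
  shows "(transpose A *v y) \<bullet> x = b \<bullet> y \<longleftrightarrow> (\<forall>i. y $ i \<noteq> 0 \<longrightarrow> row i A \<bullet> x = b $ i)"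
proof -
  have "(transpose A *v y) \<bullet> x - b \<bullet> y = (\<Sum>i\<in>UNIV. y $ i * (row i A \<bullet> x - b $ i))"
    unfolding transpose_mult_eq_sum_rows
    by (simp add: inner_sum_left inner_vec_def[of b] sum_subtractf right_diff_distrib mult.commute)
  moreover have "0 \<le> y $ i * (row i A \<bullet> x - b $ i)" for i
    using assms by (simp add: less_eq_vec_def mem_feasible_region_iff)
  ultimately have "(transpose A *v y) \<bullet> x - b \<bullet> y = 0 \<longleftrightarrow> (\<forall>i. y $ i * (row i A \<bullet> x - b $ i) = 0)"
    by (simp add: sum_nonneg_eq_0_iff)
  then show ?thesis by auto
qed

lemma closed_feasible_region: "closed (feasible_region A b)"
proof -
  have "feasible_region A b = (\<Inter>i. {x. b $ i \<le> row i A \<bullet> x})"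
    by (auto simp: mem_feasible_region_iff)
  then show ?thesis
    by (simp add: closed_INT closed_halfspace_ge)
qed

text \<open>Compactness gives a minimiser of \<open>c\<close>; the cone of its active rows contains
  \<open>c\<close>, and the weights there serve as the dual vector.\<close>

lemma exists_complementary_pair:
  fixes A :: "real ^ 'n ^ 'm"
  assumes "bounded (feasible_region A b)" and "feasible_region A b \<noteq> {}"
  obtains x y where "x \<in> feasible_region A b" and "0 \<le> y" and "transpose A *v y = c"
    and "\<And>i. y $ i \<noteq> 0 \<Longrightarrow> row i A \<bullet> x = b $ i"
proof -
  have "compact (feasible_region A b)"
    using assms(1) by (simp add: compact_eq_bounded_closed closed_feasible_region)
  then obtain x where x: "x \<in> feasible_region A b"
    and min: "\<And>z. z \<in> feasible_region A b \<Longrightarrow> c \<bullet> x \<le> c \<bullet> z"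
    using continuous_attains_inf[OF _ assms(2), of "\<lambda>x. c \<bullet> x"]
    by (auto simp: continuous_on_inner)
  have "c \<in> conic_combinations {row i A | i. row i A \<bullet> x = b $ i}"
    by (rule linear_minimizer_in_active_cone)
      (use x min in \<open>auto simp: mem_feasible_region_iff\<close>)
  then show thesis
    unfolding conic_combinations_rows_iff using that x by blast
qed

section \<open>From inverse solutions to mixed-integer solutions and back\<close>

lemma pnorm_zero [simp]: "pnorm p 0 = 0"
  by (simp add: pnorm_def infnorm_0)

text \<open>Supplies a feasible point with the same tight rows for every \<open>k\<close>, as
  \<open>mip_region\<close> demands, whereas the inverse problem restricts only the points in
  \<open>S\<close>.\<close>

lemma qio_feasible_imp_complementary_points:
  fixes xh :: "'k::finite \<Rightarrow> real ^ 'n" and A :: "real ^ 'n ^ 'm"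
  assumes bounded: "bounded (feasible_region A b)" and nonempty: "feasible_region A b \<noteq> {}"
    and qio: "qio_feasible A b l p xh \<tau> \<theta> c e y S"
  obtains x y' where "0 \<le> y'" and "transpose A *v y' = c"
    and "\<And>k. x k \<in> feasible_region A b"
    and "\<And>k i. y' $ i \<noteq> 0 \<Longrightarrow> row i A \<bullet> x k = b $ i"
    and "\<And>k. k \<in> S \<Longrightarrow> pnorm l (xh k - x k) \<le> \<tau>"
proof (cases "S = {}")
  case True
  obtain x y' where "x \<in> feasible_region A b" "0 \<le> y'" "transpose A *v y' = c"
    "\<And>i. y' $ i \<noteq> 0 \<Longrightarrow> row i A \<bullet> x = b $ i"
    using exists_complementary_pair[OF bounded nonempty, where c = c] by metis
  \<comment> \<open>The distance bound is vacuous here, so one point can serve every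
    \<open>k\<close>.\<close>
  then show thesis
    using that[of y' "\<lambda>_. x"] True by simp
next
  case False
  then obtain k0 where "k0 \<in> S" by blast
  define x where "x k = (let j = if k \<in> S then k else k0 in xh j - e j)" for k
  have y: "0 \<le> y" "transpose A *v y = c"
    using qio by (auto simp: qio_feasible_def)
  have feas: "x k \<in> feasible_region A b" and dual: "c \<bullet> x k = b \<bullet> y" for k
    using qio \<open>k0 \<in> S\<close> by (auto simp: x_def qio_feasible_def feasible_region_def)
  have "row i A \<bullet> x k = b $ i" if "y $ i \<noteq> 0" for i k
    using complementary_slackness[OF y(1) feas] dual y(2) that by auto
  moreover have "pnorm l (xh k - x k) \<le> \<tau>" if "k \<in> S" for k
    using qio that by (simp add: x_def qio_feasible_def)
  ultimately show thesis
    using that y feas by blast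
qed

theorem corollary1:
  fixes A :: "real ^ 'n ^ 'm" and b :: "real ^ 'm"
    and l p :: ereal
    and xh :: "'k::finite \<Rightarrow> real ^ 'n"
    and \<tau> \<theta> M1 M2 :: real
  assumes "bounded (feasible_region A b)"
    and "aff_dim (feasible_region A b) = int CARD('n)"
    and "no_redundant_constraint A b"
    and "1 \<le> l" and "1 \<le> p"
    and "\<forall>i. pnorm p (row i A) = 1"
    and "0 \<le> \<tau>" and "0 \<le> \<theta>" and "\<theta> \<le> 1"
    and "\<forall>i. \<forall>x\<in>feasible_region A b. row i A \<bullet> x - b $ i \<le> M1"
    and "\<forall>k. \<forall>x\<in>feasible_region A b. pnorm l (xh k - x) \<le> M2"
  shows "{c. inverse_feasible A b l p xh \<tau> \<theta> c} =
         {c \<in> (\<Union>v\<in>mip_nonzero_v A b l xh \<tau> \<theta> M1 M2.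
                 conic_combinations {row i A | i. v $ i = 1}).
            pnorm p c = 1}"
proof (intro set_eqI iffI)
  fix c assume "c \<in> {c. inverse_feasible A b l p xh \<tau> \<theta> c}"
  then obtain e y0 S where qio: "qio_feasible A b l p xh \<tau> \<theta> c e y0 S"
    by (auto simp: inverse_feasible_def)
  then have card: "\<theta> * real CARD('k) \<le> real (card S)" and norm: "pnorm p c = 1"
    by (auto simp: qio_feasible_def)
  \<comment> \<open>The empty set has affine dimension -1, so full dimension excludes it.\<close>
  have "feasible_region A b \<noteq> {}"
    using assms(2) by auto
  then obtain x y where y: "0 \<le> y" "transpose A *v y = c"
    and feas: "\<And>k. x k \<in> feasible_region A b"
    and tight: "\<And>k i. y $ i \<noteq> 0 \<Longrightarrow> row i A \<bullet> x k = b $ i"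
    and close: "\<And>k. k \<in> S \<Longrightarrow> pnorm l (xh k - x k) \<le> \<tau>"
    using qio_feasible_imp_complementary_points[OF assms(1) _ qio] by metis
  define v :: "real ^ 'm" where "v = (\<chi> i. if y $ i \<noteq> 0 then 1 else 0)"
  define u :: "real ^ 'k" where "u = (\<chi> k. if k \<in> S then 1 else 0)"
  \<comment> \<open>If \<open>y\<close> were zero, so would be \<open>c\<close>, against
    \<open>pnorm p c = 1\<close>. This keeps \<open>v\<close> out of the removed set
    \<open>{0}\<close>.\<close>
  have "y \<noteq> 0"
    using norm y(2) by auto
  then have "v \<noteq> 0"
    by (auto simp: v_def vec_eq_iff)
  have "b $ i \<le> row i A \<bullet> x k" "row i A \<bullet> x k \<le> b $ i + M1 * (1 - v $ i)" for i k
  proof -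
    show "b $ i \<le> row i A \<bullet> x k"
      using feas by (simp add: mem_feasible_region_iff)
    show "row i A \<bullet> x k \<le> b $ i + M1 * (1 - v $ i)"
      \<comment> \<open>Where \<open>v $ i = 1\<close> the row is tight; elsewhere \<open>M1\<close>
        bounds the slack.\<close>
      using bspec[OF spec[OF assms(10), of i] feas[of k]] tight[of i k] by (simp add: v_def)
  qed
  \<comment> \<open>For \<open>k\<close> outside \<open>S\<close>, \<open>M2\<close> bounds the
    distance to any feasible point, and \<open>0 \<le> \<tau>\<close> only enlarges the right-hand
    side.\<close>
  moreover have "pnorm l (xh k - x k) \<le> \<tau> + M2 * (1 - u $ k)" for k
    using bspec[OF spec[OF assms(11), of k] feas[of k]] assms(7) close[of k] by (simp add: u_def)
  moreover have "\<theta> * real CARD('k) \<le> (\<Sum>k\<in>UNIV. u $ k)"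
    using card by (simp add: u_def sum.If_cases)
  ultimately have "(v, u, \<lambda>k. xh k - x k) \<in> mip_region A b l xh \<tau> \<theta> M1 M2"
    by (simp add: mip_region_def v_def u_def)
  then have "v \<in> mip_nonzero_v A b l xh \<tau> \<theta> M1 M2"
    using \<open>v \<noteq> 0\<close> by (force simp: mip_nonzero_v_def)
  moreover have "c \<in> conic_combinations {row i A | i. v $ i = 1}"
    unfolding conic_combinations_rows_iff using y by (auto simp: v_def)
  ultimately show "c \<in> {c \<in> (\<Union>v\<in>mip_nonzero_v A b l xh \<tau> \<theta> M1 M2.
      conic_combinations {row i A | i. v $ i = 1}). pnorm p c = 1}"
    using norm by blast
next
  fix c assume c: "c \<in> {c \<in> (\<Union>v\<in>mip_nonzero_v A b l xh \<tau> \<theta> M1 M2.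
      conic_combinations {row i A | i. v $ i = 1}). pnorm p c = 1}"
  then obtain v u e where mip: "(v, u, e) \<in> mip_region A b l xh \<tau> \<theta> M1 M2"
    and "c \<in> conic_combinations {row i A | i. v $ i = 1}" and norm: "pnorm p c = 1"
    by (fastforce simp: mip_nonzero_v_def)
  then obtain y where y: "0 \<le> y" "\<And>i. y $ i \<noteq> 0 \<Longrightarrow> v $ i = 1" "transpose A *v y = c"
    unfolding conic_combinations_rows_iff by blast
  define S where "S = {k. u $ k = 1}"
  have feas: "xh k - e k \<in> feasible_region A b" for k
    using mip by (simp add: mip_region_def mem_feasible_region_iff)
  \<comment> \<open>On the support of \<open>y\<close> the \<open>M1\<close> term vanishes, so the
    upper and lower bounds of the system meet, for every \<open>k\<close> at once.\<close>
  have "row i A \<bullet> (xh k - e k) = b $ i" if "y $ i \<noteq> 0" for i k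
  proof (rule antisym)
    have "row i A \<bullet> (xh k - e k) \<le> b $ i + M1 * (1 - v $ i)"
      using mip by (simp add: mip_region_def)
    then show "row i A \<bullet> (xh k - e k) \<le> b $ i"
      using y(2)[OF that] by simp
    show "b $ i \<le> row i A \<bullet> (xh k - e k)"
      using feas by (simp add: mem_feasible_region_iff)
  qed
  then have "c \<bullet> (xh k - e k) = b \<bullet> y" for k
    using complementary_slackness[OF y(1) feas] y(3) by blast
  moreover have "pnorm l (e k) \<le> \<tau>" if "k \<in> S" for k
  proof -
    have "pnorm l (e k) \<le> \<tau> + M2 * (1 - u $ k)"
      using mip by (simp add: mip_region_def)
    then show ?thesis
      using that by (simp add: S_def)
  qed
  moreover have "\<theta> * real CARD('k) \<le> real (card S)"
  proof -
    \<comment> \<open>Since \<open>u\<close> is binary, it is the indicator of \<open>S\<close>, and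
      its entries sum to the cardinality of \<open>S\<close>.\<close>
    have "u $ k = (if k \<in> S then 1 else 0)" for k
      using mip by (auto simp: mip_region_def S_def)
    then have "(\<Sum>k\<in>UNIV. u $ k) = real (card S)"
      by (simp add: sum.If_cases)
    then show ?thesis
      using mip by (simp add: mip_region_def)
  qed
  ultimately have "qio_feasible A b l p xh \<tau> \<theta> c e y S"
    using y(1,3) feas norm by (simp add: qio_feasible_def feasible_region_def)
  then show "c \<in> {c. inverse_feasible A b l p xh \<tau> \<theta> c}"
    by (auto simp: inverse_feasible_def)
qed

end
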